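(* Suppose $\mathcal{U}$ is a p-point on $\omega$ and $\mathcal{V}$ is an arbitrary ultrafilter on $\omega$ with $\mathcal{U}\ge_T\mathcal{V}$. Then there is a continuous monotone map $f^*:\mathcal{P}(\omega)\to\mathcal{P}(\omega)$ whose restriction to $\mathcal{U}$ is continuous and has range contained in and cofinal in $(\mathcal{V},\supseteq)$. Hence there is a continuous monotone cofinal map from $\mathcal{U}$ into $\mathcal{V}$ witnessing $\mathcal{U}\ge_T\mathcal{V}$.
   Context: Ultrafilters are ordered by reverse inclusion $\supseteq$. $\mathcal{U}\ge_T\mathcal{V}$ means there is a map $f:\mathcal{U}\to\mathcal{V}$ sending every cofinal subset of $(\mathcal{U},\supseteq)$ to a cofinal subset of $(\mathcal{V},\supseteq)$ (a cofinal map). A map $f$ between families of sets is monotone if $X\subseteq Y$ implies $f(X)\subseteq f(Y)$. $\mathcal{P}(\omega)$ carries the Cantor space topology (identifying sets with characteristic functions), and subsets of it the subspace topology. A p-point is a nonprincipal ultrafilter $\mathcal{U}$ on $\omega$ such that for every $\{X_n:n<\omega\}\subseteq\mathcal{U}$ there is $X\in\mathcal{U}$ with $X\setminus X_n$ finite for all $n$. *)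

theory Defs
  imports "HOL-Analysis.Analysis"
begin

definition ultrafilter :: "'a set set \<Rightarrow> bool" where
  "ultrafilter U \<longleftrightarrow>
     UNIV \<in> U \<and> {} \<notin> U \<and>
     (\<forall>X\<in>U. \<forall>Y. X \<subseteq> Y \<longrightarrow> Y \<in> U) \<and>
     (\<forall>X\<in>U. \<forall>Y\<in>U. X \<inter> Y \<in> U) \<and>
     (\<forall>X. X \<in> U \<or> - X \<in> U)"

definition nonprincipal :: "'a set set \<Rightarrow> bool" where
  "nonprincipal U \<longleftrightarrow> \<not> (\<exists>a. U = {X. a \<in> X})"

definition p_point :: "nat set set \<Rightarrow> bool" where
  "p_point U \<longleftrightarrow> ultrafilter U \<and> nonprincipal U \<and>
     (\<forall>X :: nat \<Rightarrow> nat set. range X \<subseteq> U \<longrightarrow> (\<exists>Y\<in>U. \<forall>n. finite (Y - X n)))"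

(* Families of sets are ordered by reverse inclusion, so "above" means "contained in". *)
definition cofinal_in :: "'a set set \<Rightarrow> 'a set set \<Rightarrow> bool" where
  "cofinal_in C U \<longleftrightarrow> C \<subseteq> U \<and> (\<forall>X\<in>U. \<exists>Y\<in>C. Y \<subseteq> X)"

(* Only the values of f on U matter: f stands for its restriction to U. *)
definition cofinal_map :: "('a set \<Rightarrow> 'b set) \<Rightarrow> 'a set set \<Rightarrow> 'b set set \<Rightarrow> bool" where
  "cofinal_map f U V \<longleftrightarrow> f ` U \<subseteq> V \<and> (\<forall>C. cofinal_in C U \<longrightarrow> cofinal_in (f ` C) V)"

definition tukey_ge :: "'a set set \<Rightarrow> 'b set set \<Rightarrow> bool"  (infix "\<ge>\<^sub>T" 50) where
  "U \<ge>\<^sub>T V \<longleftrightarrow> (\<exists>f. cofinal_map f U V)"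

(* The topology on the power set transported from the product topology on
   nat => bool (bool being discrete) along the characteristic function. *)
definition cantor_topology :: "nat set topology" where
  "cantor_topology =
     pullback_topology UNIV (\<lambda>X n. n \<in> X)
       (product_topology (\<lambda>_. discrete_topology (UNIV :: bool set)) UNIV)"

end

theory Submission
  imports Defs
begin

text \<open>
  A cofinal map can be replaced by a monotone map f with cofinal range. For each n choose X n in U
  small enough that, whenever s is a subset of n, k is at most n and k is omitted by f (s \<union> W) for
  some W in U, then k is already omitted by f (s \<union> X n). As U is a p-point, there is Z in U such
  that Z - n is contained in X n for infinitely many n. For such n the question whether k \<le> n
  belongs to f Y, where Y in U is a subset of Z, is decided by the finite set Y \<inter> n. Hence f is
  continuous below Z, and the finite decisions define the required map on all sets.
\<close>

section \<open>Cofinal maps between ultrafilters\<close>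

lemma ultrafilter_UNIV: "ultrafilter U \<Longrightarrow> UNIV \<in> U"
  and ultrafilter_empty: "ultrafilter U \<Longrightarrow> {} \<notin> U"
  and ultrafilter_mono: "ultrafilter U \<Longrightarrow> X \<in> U \<Longrightarrow> X \<subseteq> Y \<Longrightarrow> Y \<in> U"
  and ultrafilter_Int: "ultrafilter U \<Longrightarrow> X \<in> U \<Longrightarrow> Y \<in> U \<Longrightarrow> X \<inter> Y \<in> U"
  and ultrafilter_Compl: "ultrafilter U \<Longrightarrow> X \<in> U \<or> - X \<in> U"
  unfolding ultrafilter_def by blast+

lemma ultrafilter_INT_finite:
  assumes "ultrafilter U" "finite I" "\<And>i. i \<in> I \<Longrightarrow> A i \<in> U"
  shows "(\<Inter>i\<in>I. A i) \<in> U"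
  using assms(2,3)
  by (induction I rule: finite_induct) (auto intro: ultrafilter_UNIV ultrafilter_Int assms(1))

lemma nonprincipal_Compl_singleton:
  assumes "ultrafilter U" "nonprincipal U"
  shows "- {a} \<in> U"
proof (rule ccontr)
  assume "- {a} \<notin> U"
  then have a: "{a} \<in> U"
    using ultrafilter_Compl[OF assms(1)] by blast
  have "X \<in> U \<longleftrightarrow> a \<in> X" for X
  proof
    assume "X \<in> U"
    then have "{a} \<inter> X \<in> U"
      using a assms(1) by (blast intro: ultrafilter_Int)
    then show "a \<in> X"
      using ultrafilter_empty[OF assms(1)] by (cases "a \<in> X") auto
  next
    assume "a \<in> X"
    then show "X \<in> U"
      using ultrafilter_mono[OF assms(1) a] by blast
  qed
  then have "U = {X. a \<in> X}"
    by blast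
  with assms(2) show False
    unfolding nonprincipal_def by blast
qed

lemma nonprincipal_Diff_finite:
  assumes "ultrafilter U" "nonprincipal U" "X \<in> U" "finite F"
  shows "X - F \<in> U"
proof -
  have "X \<inter> (\<Inter>a\<in>F. - {a}) \<in> U"
    using assms by (intro ultrafilter_Int ultrafilter_INT_finite nonprincipal_Compl_singleton)
  moreover have "X \<inter> (\<Inter>a\<in>F. - {a}) = X - F"
    by blast
  ultimately show ?thesis
    by simp
qed

text \<open>Below each \<open>X\<close> in \<open>U\<close> lies some member of a cofinal
  \<open>C\<close>, and monotonicity puts its value below \<open>f X\<close>. So the single cofinal
  set \<open>U\<close> decides the matter.\<close>

lemma mono_on_cofinal_map:
  assumes "mono_on U f" "f ` U \<subseteq> V" "cofinal_in (f ` U) V"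
  shows "cofinal_map f U V"
  unfolding cofinal_map_def
proof (intro conjI allI impI)
  fix C
  assume C: "cofinal_in C U"
  have "\<exists>Y\<in>f ` C. Y \<subseteq> Z" if "Z \<in> V" for Z
  proof -
    obtain X where X: "X \<in> U" "f X \<subseteq> Z"
      using assms(3) \<open>Z \<in> V\<close> unfolding cofinal_in_def by blast
    obtain Y where Y: "Y \<in> C" "Y \<in> U" "Y \<subseteq> X"
      using C X(1) unfolding cofinal_in_def by blast
    then have "f Y \<subseteq> f X"
      using assms(1) X(1) by (meson monotone_onD)
    with X Y show ?thesis
      by blast
  qed
  moreover have "f ` C \<subseteq> V"
    using C assms(2) unfolding cofinal_in_def by blast
  ultimately show "cofinal_in (f ` C) V"
    unfolding cofinal_in_def by simp
qed (fact assms(2))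

lemma tukey_ge_monotone:
  assumes "U \<ge>\<^sub>T V" "ultrafilter V"
  obtains f where "mono_on U f" "f ` U \<subseteq> V" "cofinal_in (f ` U) V"
proof -
  obtain g where g: "cofinal_map g U V"
    using assms(1) unfolding tukey_ge_def by blast
  \<comment> \<open>The union over all members of \<open>U\<close> below \<open>X\<close> makes the
    map monotone; it contains \<open>g X\<close>, hence stays in \<open>V\<close>.\<close>
  define f where "f X = \<Union>(g ` {Y \<in> U. Y \<subseteq> X})" for X
  have mono: "mono_on U f"
    by (rule monotone_onI) (auto simp: f_def)
  have range: "f ` U \<subseteq> V"
  proof
    fix Z
    assume "Z \<in> f ` U"
    then obtain X where X: "X \<in> U" "Z = f X"
      by blast
    then have "g X \<in> V" "g X \<subseteq> Z"
      using g unfolding cofinal_map_def f_def by auto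
    then show "Z \<in> V"
      by (rule ultrafilter_mono[OF assms(2)])
  qed
  have "\<exists>Y\<in>f ` U. Y \<subseteq> Z" if Z: "Z \<in> V" for Z
  proof -
    \<comment> \<open>No value of \<open>g\<close> on \<open>C\<close> lies below \<open>Z\<close>,
      so \<open>C\<close> cannot be cofinal. Some \<open>X\<close> in \<open>U\<close> thus has no
      member of \<open>C\<close> below it, which means that every set joined in \<open>f X\<close>
      is contained in \<open>Z\<close>.\<close>
    define C where "C = {Y \<in> U. \<not> g Y \<subseteq> Z}"
    have "\<not> cofinal_in (g ` C) V"
      using Z unfolding cofinal_in_def C_def by blast
    then have "\<not> cofinal_in C U"
      using g unfolding cofinal_map_def by blast
    then obtain X where "X \<in> U" "\<forall>Y\<in>C. \<not> Y \<subseteq> X"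
      unfolding cofinal_in_def C_def by blast
    then have "X \<in> U" "f X \<subseteq> Z"
      unfolding f_def C_def by auto
    then show ?thesis
      by blast
  qed
  then have "cofinal_in (f ` U) V"
    using range unfolding cofinal_in_def by blast
  with mono range show thesis
    by (rule that)
qed

section \<open>Diagonalization in a p-point\<close>

text \<open>A pseudo-intersection gives finitely many exceptions for each \<open>X n\<close>, but
  these may lie beyond \<open>n\<close>. Deleting alternate blocks of a fast partition of the
  naturals leaves, for infinitely many \<open>n\<close>, only exceptions below
  \<open>n\<close>.\<close>

lemma p_point_diagonal:
  assumes "p_point U" "\<And>n. X n \<in> U"
  obtains Z where "Z \<in> U" "\<And>k. \<exists>n\<ge>k. Z - {..<n} \<subseteq> X n"
proof -
  have U: "ultrafilter U"
    using assms(1) unfolding p_point_def by blast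
  have "range X \<subseteq> U"
    using assms(2) by blast
  then obtain Y where Y: "Y \<in> U" "\<And>n. finite (Y - X n)"
    using assms(1) unfolding p_point_def by blast
  have "\<exists>m>n. Y - {..<m} \<subseteq> X n" for n
  proof -
    obtain b where "\<forall>x\<in>Y - X n. x < b"
      using Y(2) finite_nat_set_iff_bounded by blast
    \<comment> \<open>The bound \<open>b\<close> covers the exceptions; \<open>Suc n\<close> forces
      the next index above \<open>n\<close>, so that iteration is strictly increasing.\<close>
    then have "Y - {..<max b (Suc n)} \<subseteq> X n"
      by (auto simp: less_max_iff_disj)
    then show ?thesis
      by (intro exI[of _ "max b (Suc n)"]) auto
  qed
  then obtain h where h: "\<And>n. n < h n" "\<And>n. Y - {..<h n} \<subseteq> X n"
    by metis
  define a where "a i = (h ^^ i) 0" for i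
  have a_Suc: "a (Suc i) = h (a i)" for i
    by (simp add: a_def)
  have "strict_mono a"
    using h(1) by (simp add: strict_mono_Suc_iff a_Suc)
  have a_ge: "i \<le> a i" for i
    using \<open>strict_mono a\<close> by (rule strict_mono_imp_increasing)
  \<comment> \<open>A set in U that misses the interval between a i and a (Suc i) for every i of one parity
    avoids the finite exceptions to almost inclusion at a i.\<close>
  define E where "E = (\<Union>i. {a (2 * i)..<a (2 * i + 1)})"
  from ultrafilter_Compl[OF U, of E] show thesis
  proof
    assume "E \<in> U"
    then have "Y \<inter> E \<in> U"
      using U Y(1) by (blast intro: ultrafilter_Int)
    moreover have "\<exists>n\<ge>k. Y \<inter> E - {..<n} \<subseteq> X n" for k
    proof (intro exI conjI)
      show "k \<le> a (2 * k + 1)"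
        using a_ge[of "2 * k + 1"] by simp
      show "Y \<inter> E - {..<a (2 * k + 1)} \<subseteq> X (a (2 * k + 1))"
      proof
        fix m
        assume m: "m \<in> Y \<inter> E - {..<a (2 * k + 1)}"
        then obtain j where j: "a (2 * j) \<le> m" "m < a (2 * j + 1)"
          unfolding E_def by auto
        with m have "a (2 * k + 1) < a (2 * j + 1)"
          by simp
        \<comment> \<open>Parity enters here: \<open>2 * k + 1 < 2 * j + 1\<close> gives
          \<open>2 * k + 2 \<le> 2 * j\<close>, so \<open>m\<close> lies past the whole gap that
          starts at \<open>a (2 * k + 1)\<close>.\<close>
        then have "Suc (2 * k + 1) \<le> 2 * j"
          using \<open>strict_mono a\<close> by (simp add: strict_mono_less)
        then have "a (Suc (2 * k + 1)) \<le> m"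
          using \<open>strict_mono a\<close> j(1) by (meson order_trans strict_mono_less_eq)
        with m show "m \<in> X (a (2 * k + 1))"
          using h(2)[of "a (2 * k + 1)"] by (auto simp: a_Suc)
      qed
    qed
    ultimately show thesis
      by (rule that)
  next
    assume "- E \<in> U"
    then have "Y \<inter> - E \<in> U"
      using U Y(1) by (blast intro: ultrafilter_Int)
    moreover have "\<exists>n\<ge>k. Y \<inter> - E - {..<n} \<subseteq> X n" for k
    proof (intro exI conjI)
      show "k \<le> a (2 * k)"
        using a_ge[of "2 * k"] by simp
      show "Y \<inter> - E - {..<a (2 * k)} \<subseteq> X (a (2 * k))"
      proof
        fix m
        assume m: "m \<in> Y \<inter> - E - {..<a (2 * k)}"
        then have "a (Suc (2 * k)) \<le> m"
          unfolding E_def by (auto simp: not_less)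
        with m show "m \<in> X (a (2 * k))"
          using h(2)[of "a (2 * k)"] by (auto simp: a_Suc)
      qed
    qed
    ultimately show thesis
      by (rule that)
  qed
qed

text \<open>Only finitely many pairs of \<open>s\<close> and \<open>k\<close> occur, and by
  monotonicity an omission survives shrinking the set. Hence one witness per pair can be chosen and
  all of them intersected.\<close>

lemma ultrafilter_omitting_set:
  fixes f :: "nat set \<Rightarrow> nat set"
  assumes U: "ultrafilter U" and mono: "mono_on U f"
  obtains X where "X \<in> U"
    "\<And>s k W. s \<subseteq> {..<n} \<Longrightarrow> k \<le> n \<Longrightarrow> W \<in> U \<Longrightarrow> k \<notin> f (s \<union> W) \<Longrightarrow> k \<notin> f (s \<union> X)"
proof -
  \<comment> \<open>For a pair without a witness \<open>UNIV\<close> serves as a default, which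
    makes the choice total.\<close>
  have "\<forall>p. \<exists>W\<in>U. (\<exists>W\<in>U. snd p \<notin> f (fst p \<union> W)) \<longrightarrow> snd p \<notin> f (fst p \<union> W)"
    using ultrafilter_UNIV[OF U] by blast
  then obtain A where A: "\<And>p. A p \<in> U"
    "\<And>p W. W \<in> U \<Longrightarrow> snd p \<notin> f (fst p \<union> W) \<Longrightarrow> snd p \<notin> f (fst p \<union> A p)"
    by metis
  define I where "I = Pow {..<n} \<times> {..n}"
  define X where "X = (\<Inter>p\<in>I. A p)"
  have X: "X \<in> U"
    unfolding X_def by (rule ultrafilter_INT_finite[OF U]) (auto simp: I_def A(1))
  moreover have "k \<notin> f (s \<union> X)"
    if "s \<subseteq> {..<n}" "k \<le> n" "W \<in> U" "k \<notin> f (s \<union> W)" for s k W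
  proof -
    have "s \<union> X \<in> U" "s \<union> A (s, k) \<in> U"
      using ultrafilter_mono[OF U] X A(1) by blast+
    moreover have "s \<union> X \<subseteq> s \<union> A (s, k)"
      using that unfolding X_def I_def by auto
    ultimately have "f (s \<union> X) \<subseteq> f (s \<union> A (s, k))"
      by (rule monotone_onD[OF mono])
    then show ?thesis
      using A(2)[of W "(s, k)"] that by auto
  qed
  ultimately show thesis
    by (rule that)
qed

section \<open>Continuity in the Cantor space\<close>

lemma topspace_cantor_topology [simp]: "topspace cantor_topology = UNIV"
  unfolding cantor_topology_def by (simp add: topspace_pullback_topology)

lemma openin_cantor_cylinder: "openin cantor_topology {Y. Y \<inter> {..<n} = X \<inter> {..<n}}"
proof -
  let ?B = "\<lambda>m. if m < n then {m \<in> X} else UNIV"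
  have "openin (product_topology (\<lambda>_. discrete_topology (UNIV :: bool set)) UNIV) (PiE UNIV ?B)"
    by (subst openin_PiE_gen) (auto intro: finite_subset[of _ "{..<n}"])
  moreover have "{Y. Y \<inter> {..<n} = X \<inter> {..<n}} = (\<lambda>Y m. m \<in> Y) -` PiE UNIV ?B \<inter> UNIV"
    by (auto simp: PiE_iff split: if_splits)
  ultimately show ?thesis
    unfolding cantor_topology_def openin_pullback_topology by blast
qed

text \<open>\<open>N k\<close> is a modulus of continuity: coordinate \<open>k\<close> of the value
  is constant on cylinders of length \<open>N k\<close>, and continuity into a product is checked
  coordinatewise.\<close>

lemma continuous_map_cantorI:
  assumes "\<And>k X. k \<in> f X \<longleftrightarrow> k \<in> f (X \<inter> {..<N k})"
  shows "continuous_map cantor_topology cantor_topology f"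
proof -
  have coord: "continuous_map cantor_topology (discrete_topology UNIV) (\<lambda>X. k \<in> f X)" for k
    unfolding continuous_map_def
  proof (intro conjI allI impI)
    fix B :: "bool set"
    have "\<exists>T. openin cantor_topology T \<and> X \<in> T \<and> T \<subseteq> {Y. (k \<in> f Y) \<in> B}"
      if "(k \<in> f X) \<in> B" for X
    proof (intro exI conjI)
      show "{Y. Y \<inter> {..<N k} = X \<inter> {..<N k}} \<subseteq> {Y. (k \<in> f Y) \<in> B}"
      proof
        fix Y
        assume "Y \<in> {Y. Y \<inter> {..<N k} = X \<inter> {..<N k}}"
        then have "k \<in> f Y \<longleftrightarrow> k \<in> f X"
          using assms[of k X] assms[of k Y] by simp
        with that show "Y \<in> {Y. (k \<in> f Y) \<in> B}"
          by simp
      qed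
    qed (auto simp: openin_cantor_cylinder)
    then show "openin cantor_topology {X \<in> topspace cantor_topology. (k \<in> f X) \<in> B}"
      by (subst openin_subopen) auto
  qed simp
  then have "continuous_map cantor_topology
      (product_topology (\<lambda>_. discrete_topology (UNIV :: bool set)) UNIV) ((\<lambda>X n. n \<in> X) \<circ> f)"
    by (simp add: continuous_map_componentwise_UNIV)
  then show ?thesis
    by (subst (2) cantor_topology_def) (rule continuous_map_pullback', auto)
qed

lemma p_point_continuous_extension:
  fixes f :: "nat set \<Rightarrow> nat set"
  assumes "p_point U" and mono: "mono_on U f"
  obtains F Z where "continuous_map cantor_topology cantor_topology F" "mono F" "Z \<in> U"
    "\<And>Y. Y \<in> U \<Longrightarrow> F Y = f (Y \<inter> Z)"
proof -
  have U: "ultrafilter U" and np: "nonprincipal U"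
    using assms(1) unfolding p_point_def by blast+
  have "\<exists>X. X \<in> U \<and> (\<forall>s k W. s \<subseteq> {..<n} \<longrightarrow> k \<le> n \<longrightarrow> W \<in> U \<longrightarrow> k \<notin> f (s \<union> W) \<longrightarrow> k \<notin> f (s \<union> X))"
    for n
    by (rule ultrafilter_omitting_set[OF U mono, of n]) blast
  then obtain X where X: "\<And>n. X n \<in> U"
    "\<And>n s k W. s \<subseteq> {..<n} \<Longrightarrow> k \<le> n \<Longrightarrow> W \<in> U \<Longrightarrow> k \<notin> f (s \<union> W) \<Longrightarrow> k \<notin> f (s \<union> X n)"
    by metis
  obtain Z where Z: "Z \<in> U" "\<And>k. \<exists>n\<ge>k. Z - {..<n} \<subseteq> X n"
    using p_point_diagonal[of U X] assms(1) X(1) by metis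
  \<comment> \<open>The bound \<open>k \<le> N k\<close> places \<open>k\<close> among the numbers
    whose omission \<open>X (N k)\<close> settles.\<close>
  then obtain N where N: "\<And>k. k \<le> N k" "\<And>k. Z - {..<N k} \<subseteq> X (N k)"
    by metis
  \<comment> \<open>Above \<open>N k\<close> all of \<open>Z\<close> is filled in. So
    \<open>G k Y\<close> depends on a finite part of \<open>Y\<close> only, and it belongs to
    \<open>U\<close> even if \<open>Y\<close> does not, which is where monotonicity of
    \<open>f\<close> can be used.\<close>
  define G where "G k Y = (Y \<inter> Z \<inter> {..<N k}) \<union> (Z - {..<N k})" for k Y
  define F where "F Y = {k. k \<in> f (G k Y)}" for Y
  have G_in: "G k Y \<in> U" for k Y
    using nonprincipal_Diff_finite[OF U np Z(1), of "{..<N k}"]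
    unfolding G_def by (rule ultrafilter_mono[OF U]) auto
  have "G k (Y \<inter> {..<N k}) = G k Y" for k Y
    unfolding G_def by blast
  then have "continuous_map cantor_topology cantor_topology F"
    by (intro continuous_map_cantorI[of _ N]) (simp add: F_def)
  moreover have "mono F"
  proof (rule monoI)
    fix Y Y' :: "nat set"
    assume "Y \<subseteq> Y'"
    then have "G k Y \<subseteq> G k Y'" for k
      unfolding G_def by blast
    then have "f (G k Y) \<subseteq> f (G k Y')" for k
      using mono G_in by (meson monotone_onD)
    then show "F Y \<subseteq> F Y'"
      unfolding F_def by blast
  qed
  moreover have "F Y = f (Y \<inter> Z)" if "Y \<in> U" for Y
  proof -
    have YZ: "Y \<inter> Z \<in> U"
      using U that Z(1) by (rule ultrafilter_Int)
    have "k \<in> f (G k Y) \<longleftrightarrow> k \<in> f (Y \<inter> Z)" for k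
    proof
      assume "k \<in> f (Y \<inter> Z)"
      moreover have "Y \<inter> Z \<subseteq> G k Y"
        unfolding G_def by blast
      then have "f (Y \<inter> Z) \<subseteq> f (G k Y)"
        by (rule monotone_onD[OF mono YZ G_in])
      ultimately show "k \<in> f (G k Y)"
        by blast
    next
      assume k: "k \<in> f (G k Y)"
      \<comment> \<open>If \<open>Y \<inter> Z\<close> omitted \<open>k\<close> under
        \<open>f\<close>, then it would be a witness \<open>W\<close> for \<open>s\<close>, so
        \<open>f (s \<union> X (N k))\<close> and its subset \<open>f (G k Y)\<close> would omit
        \<open>k\<close> as well.\<close>
      define s where "s = Y \<inter> Z \<inter> {..<N k}"
      have "G k Y \<subseteq> s \<union> X (N k)"
        using N(2)[of k] unfolding G_def s_def by blast
      moreover have "s \<union> X (N k) \<in> U"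
        using X(1) by (rule ultrafilter_mono[OF U]) blast
      ultimately have "f (G k Y) \<subseteq> f (s \<union> X (N k))"
        using monotone_onD[OF mono G_in] by blast
      with k have "k \<in> f (s \<union> Y \<inter> Z)"
        using X(2)[of s "N k" k "Y \<inter> Z"] N(1) YZ by (auto simp: s_def)
      moreover have "s \<union> Y \<inter> Z = Y \<inter> Z"
        unfolding s_def by blast
      ultimately show "k \<in> f (Y \<inter> Z)"
        by simp
    qed
    then show ?thesis
      unfolding F_def by blast
  qed
  ultimately show thesis
    using Z(1) by (intro that)
qed

theorem theorem20:
  fixes U V :: "nat set set"
  assumes "p_point U"
    and "ultrafilter V"
    and "U \<ge>\<^sub>T V"
  shows "(\<exists>fstar :: nat set \<Rightarrow> nat set.
            continuous_map cantor_topology cantor_topology fstar \<and>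
            mono fstar \<and>
            continuous_map (subtopology cantor_topology U) (subtopology cantor_topology V) fstar \<and>
            cofinal_in (fstar ` U) V) \<and>
         (\<exists>f :: nat set \<Rightarrow> nat set.
            continuous_map (subtopology cantor_topology U) (subtopology cantor_topology V) f \<and>
            mono_on U f \<and>
            cofinal_map f U V)"
proof -
  have U: "ultrafilter U"
    using assms(1) unfolding p_point_def by blast
  obtain f where f: "mono_on U f" "f ` U \<subseteq> V" "cofinal_in (f ` U) V"
    using tukey_ge_monotone[OF assms(3,2)] by blast
  obtain F Z where F: "continuous_map cantor_topology cantor_topology F" "mono F"
    and Z: "Z \<in> U" and FZ: "\<And>Y. Y \<in> U \<Longrightarrow> F Y = f (Y \<inter> Z)"
    using p_point_continuous_extension[OF assms(1) f(1)] by blast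
  have Int_Z: "Y \<inter> Z \<in> U" if "Y \<in> U" for Y
    using U that Z by (rule ultrafilter_Int)
  have range: "F ` U \<subseteq> V"
    using f(2) Int_Z by (auto simp: FZ)
  \<comment> \<open>Replacing \<open>Y\<close> by \<open>Y \<inter> Z\<close> only shrinks the value
    of \<open>f\<close>, so cofinality passes from the range of \<open>f\<close> to that of
    \<open>F\<close>.\<close>
  have "\<exists>Y\<in>F ` U. Y \<subseteq> W" if "W \<in> V" for W
  proof -
    obtain Y where Y: "Y \<in> U" "f Y \<subseteq> W"
      using f(3) \<open>W \<in> V\<close> unfolding cofinal_in_def by blast
    moreover have "f (Y \<inter> Z) \<subseteq> f Y"
      using monotone_onD[OF f(1) Int_Z[OF Y(1)] Y(1)] by blast
    ultimately show ?thesis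
      using FZ by blast
  qed
  then have cof: "cofinal_in (F ` U) V"
    using range unfolding cofinal_in_def by blast
  have cont: "continuous_map (subtopology cantor_topology U) (subtopology cantor_topology V) F"
    using F(1) range
    by (auto simp: continuous_map_in_subtopology intro: continuous_map_from_subtopology)
  have mono: "mono_on U F"
    using F(2) by (auto intro: mono_on_subset)
  then have "cofinal_map F U V"
    using range cof by (rule mono_on_cofinal_map)
  with F cont cof mono show ?thesis
    by blast
qed

end
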